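(* Let $f\in\mathbb{Z}[t_1^{\pm1},\dots,t_n^{\pm1}]$ be a nonzero Laurent polynomial whose Newton polyhedron $N(f)$ has dimension $m$, and fix a coordinate system with $m$ essential variables for $f$. Then the reduced Laurent norm unit ball $$\tilde{\mathcal{B}}_f=\{\phi\in(\mathbb{R}^m)^*\mid \|\phi\|_f\le 1\}$$ is a convex polyhedron, where $(\mathbb{R}^m)^*$ is the space spanned by the essential variables.
   Context: For nonzero $f=\sum c_\alpha\mathbf{t}^\alpha\in\mathbb{Z}[t_1^{\pm1},\dots,t_n^{\pm1}]$, let $\operatorname{supp}(f)=\{\alpha\in\mathbb{Z}^n:c_\alpha\ne0\}$; the Newton polyhedron $N(f)$ is the convex hull of $\operatorname{supp}(f)$ in $\mathbb{R}^n$, and $m=\dim N(f)\le n$ is its (affine) dimension. The Laurent norm of $\phi\in(\mathbb{R}^n)^*$ is $\|\phi\|_f=\sup_{\alpha,\beta\in\operatorname{supp}(f)}\phi(\alpha-\beta)$. Essential variables: choose an affine coordinate system $(x_1,\dots,x_n)$ of $\mathbb{R}^n$ (i.e. an affine bijection $A:\mathbb{R}^n\to\mathbb{R}^n$) in which the last $n-m$ coordinates vanish identically on $N(f)$, i.e. $A(N(f))\subset\mathbb{R}^m\times\{0\}$. The set $\operatorname{supp}(f)$ and the polyhedron $N(f)$ are then expressed in these coordinates (replaced by their images under $A$), dual vectors are written $\phi=(\phi_1,\dots,\phi_n)$ with $\phi(x)=\sum_i\phi_ix_i$, and $\|\phi\|_f$ is given by the same formula using the exponents in these coordinates. The coordinates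 $(x_1,\dots,x_m)$, and dually $(\phi_1,\dots,\phi_m)$, are the essential variables; $(\mathbb{R}^m)^*$ is the subspace of dual vectors with $\phi_{m+1}=\dots=\phi_n=0$. A convex polyhedron is by definition the convex hull of a finite set of points (so it is bounded). *)

theory Defs
  imports "HOL-Analysis.Analysis" "HOL-Library.Poly_Mapping"
begin

text \<open>
  The ring \<open>\<int>[t\<^sub>1\<^sup>\<plusminus>\<^sup>1, \<dots>, t\<^sub>n\<^sup>\<plusminus>\<^sup>1]\<close> is the group ring \<open>\<int>[\<int>\<^sup>n]\<close>: finitely supported functions from
  exponent vectors to integer coefficients, with convolution as multiplication; \<open>n = CARD('n)\<close>.
\<close>

type_synonym 'n laurent_poly = "(int ^ 'n) \<Rightarrow>\<^sub>0 int"

definition laurent_supp :: "'n::finite laurent_poly \<Rightarrow> (real ^ 'n) set" where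
  "laurent_supp f = (\<lambda>\<alpha>. \<chi> i. real_of_int (\<alpha> $ i)) ` Poly_Mapping.keys f"

definition newton_polyhedron :: "'n::finite laurent_poly \<Rightarrow> (real ^ 'n) set" where
  "newton_polyhedron f = convex hull (laurent_supp f)"

text \<open>
  The Laurent norm attached to a set \<open>S\<close> of exponents: \<open>S = laurent_supp f\<close> gives the norm in the
  original coordinates, \<open>S = A ` laurent_supp f\<close> the norm in the coordinates \<open>A\<close>.  A dual vector is
  given by its components and acts by \<open>\<phi>(x) = (\<Sum>i. \<phi>\<^sub>i x\<^sub>i) = \<phi> \<bullet> x\<close>.  The supremum is that of a
  conditionally complete lattice, hence meaningful for finite nonempty \<open>S\<close>.
\<close>

definition laurent_norm :: "(real ^ 'n::finite) set \<Rightarrow> real ^ 'n \<Rightarrow> real" where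
  "laurent_norm S \<phi> = (SUP (\<alpha>, \<beta>) \<in> S \<times> S. \<phi> \<bullet> (\<alpha> - \<beta>))"

definition affine_bijection :: "(real ^ 'n::finite \<Rightarrow> real ^ 'n) \<Rightarrow> bool" where
  "affine_bijection A \<longleftrightarrow> bij A \<and> (\<exists>L b. linear L \<and> (\<forall>x. A x = L x + b))"

text \<open>
  The index type \<open>'n\<close> carries no order, so the numbering \<open>x\<^sub>1, \<dots>, x\<^sub>n\<close> of the coordinates is given
  by a bijection \<open>e\<close> from \<open>{1..n}\<close> onto \<open>'n\<close>: the \<open>k\<close>-th coordinate of \<open>x\<close> is \<open>x $ e k\<close>.
\<close>

definition coord_numbering :: "(nat \<Rightarrow> 'n::finite) \<Rightarrow> bool" where
  "coord_numbering e \<longleftrightarrow> bij_betw e {1..CARD('n)} UNIV"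

text \<open>
  The subspace on which the last \<open>n - m\<close> coordinates vanish.  It is used both for \<open>\<real>\<^sup>m \<times> {0}\<close> and,
  on dual vectors, for \<open>(\<real>\<^sup>m)\<^sup>*\<close> as a subspace of \<open>(\<real>\<^sup>n)\<^sup>*\<close>.
\<close>

definition first_coords_subspace :: "(nat \<Rightarrow> 'n::finite) \<Rightarrow> nat \<Rightarrow> (real ^ 'n) set" where
  "first_coords_subspace e m = {x. \<forall>k \<in> {m<..CARD('n)}. x $ e k = 0}"

definition essential_coordinates ::
    "'n::finite laurent_poly \<Rightarrow> nat \<Rightarrow> (nat \<Rightarrow> 'n) \<Rightarrow> (real ^ 'n \<Rightarrow> real ^ 'n) \<Rightarrow> bool" where
  "essential_coordinates f m e A \<longleftrightarrow>
     coord_numbering e \<and> affine_bijection A \<and>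
     A ` newton_polyhedron f \<subseteq> first_coords_subspace e m"

definition reduced_unit_ball ::
    "'n::finite laurent_poly \<Rightarrow> nat \<Rightarrow> (nat \<Rightarrow> 'n) \<Rightarrow> (real ^ 'n \<Rightarrow> real ^ 'n) \<Rightarrow> (real ^ 'n) set" where
  "reduced_unit_ball f m e A =
     {\<phi> \<in> first_coords_subspace e m. laurent_norm (A ` laurent_supp f) \<phi> \<le> 1}"

end

theory Submission
  imports Defs
begin

text \<open>
  In essential coordinates the differences of exponents span \<open>\<real>\<^sup>m\<close>.  The reduced unit ball is cut out
  of \<open>\<real>\<^sup>m\<close> by the finitely many half-spaces \<open>\<phi> \<bullet> (\<alpha> - \<beta>) \<le> 1\<close>, and since their normals are closed
  under negation and span \<open>\<real>\<^sup>m\<close>, it is bounded.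
\<close>

text \<open>Linear functionals given by members of \<open>D\<close> are bounded on the set by
  hypothesis, hence so are those given by any linear combination. Since the set lies in
  \<open>span D\<close>, this controls every coordinate.\<close>

lemma bounded_dual_of_span:
  fixes D :: "'a::euclidean_space set"
  shows "bounded {x \<in> span D. \<forall>d\<in>D. \<bar>x \<bullet> d\<bar> \<le> 1}" (is "bounded ?B")
proof -
  have bdd: "bounded ((\<lambda>x. x \<bullet> w) ` ?B)" if "w \<in> span D" for w
    using that
  proof (induction rule: span_induct_alt)
    case base
    show ?case
      by (rule boundedI[of _ 0]) auto
  next
    case (step c d y)
    have "bounded ((\<lambda>x. x \<bullet> d) ` ?B)"
      using step.hyps by (intro boundedI[of _ 1]) auto
    from bounded_plus_comp[OF bounded_scaleR_comp[OF this, of c] step.IH] show ?case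
      by (simp add: inner_right_distrib)
  qed
  have "bounded ((\<lambda>x. x \<bullet> b) ` ?B)" for b
  proof -
    \<comment> \<open>Only the component \<open>v\<close> of \<open>b\<close> in
      \<open>span D\<close> matters: \<open>u\<close> is orthogonal to \<open>span D\<close>, which
      contains \<open>?B\<close>.\<close>
    obtain v u where v: "v \<in> span D" and u: "\<And>w. w \<in> span D \<Longrightarrow> orthogonal u w" and "b = v + u"
      using orthogonal_subspace_decomp_exists by metis
    moreover have "x \<bullet> u = 0" if "x \<in> ?B" for x
      using u[of x] that by (simp add: orthogonal_def inner_commute)
    ultimately have "(\<lambda>x. x \<bullet> b) ` ?B = (\<lambda>x. x \<bullet> v) ` ?B"
      by (intro image_cong) (auto simp: inner_right_distrib)
    with bdd[OF v] show ?thesis by simp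
  qed
  then have "\<forall>b. \<exists>C. \<forall>x\<in>?B. \<bar>x \<bullet> b\<bar> \<le> C"
    by (simp add: bounded_iff)
  from choice[OF this] obtain C where C: "\<And>b x. x \<in> ?B \<Longrightarrow> \<bar>x \<bullet> b\<bar> \<le> C b"
    by blast
  show ?thesis
  proof (rule boundedI)
    fix x assume "x \<in> ?B"
    then show "norm x \<le> (\<Sum>b\<in>Basis. C b)"
      by (intro order_trans[OF norm_le_l1] sum_mono C)
  qed
qed

text \<open>Finitely many half-spaces within a subspace give a polyhedron. Symmetry of
  \<open>D\<close> turns the one-sided bounds into two-sided ones, so the polyhedron is
  bounded.\<close>

lemma polytope_dual_of_span:
  fixes D :: "'a::euclidean_space set"
  assumes "finite D" and "\<And>d. d \<in> D \<Longrightarrow> - d \<in> D"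
  shows "polytope {x \<in> span D. \<forall>d\<in>D. x \<bullet> d \<le> 1}" (is "polytope ?P")
proof -
  have "?P = span D \<inter> \<Inter> ((\<lambda>d. {x. d \<bullet> x \<le> 1}) ` D)"
    by (auto simp: inner_commute)
  moreover have "polyhedron (span D)"
    by (simp add: affine_imp_polyhedron subspace_imp_affine)
  ultimately have "polyhedron ?P"
    using assms(1) by (auto intro!: polyhedron_halfspace_le)
  moreover have "?P \<subseteq> {x \<in> span D. \<forall>d\<in>D. \<bar>x \<bullet> d\<bar> \<le> 1}"
    using assms(2) by (force simp: abs_le_iff)
  ultimately show ?thesis
    unfolding polytope_eq_bounded_polyhedron
    using bounded_subset[OF bounded_dual_of_span] by blast
qed

lemma subspace_first_coords_subspace: "subspace (first_coords_subspace e m)"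
  by (auto simp: first_coords_subspace_def subspace_def)

text \<open>As \<open>e\<close> is a bijection, the vanishing coordinates are exactly those outside
  the image of \<open>{1..m}\<close>, which has \<open>m\<close> elements.\<close>

lemma dim_first_coords_subspace:
  fixes e :: "nat \<Rightarrow> 'n::finite"
  assumes "coord_numbering e" and "m \<le> CARD('n)"
  shows "dim (first_coords_subspace e m) = m"
proof -
  have inj: "inj_on e {1..CARD('n)}" and surj: "e ` {1..CARD('n)} = UNIV"
    using assms(1) by (auto simp: coord_numbering_def bij_betw_def)
  have "- e ` {1..m} = e ` ({1..CARD('n)} - {1..m})"
    using inj_on_image_set_diff[OF inj, of "{1..CARD('n)}" "{1..m}"] surj assms(2)
    by (auto simp: Compl_eq_Diff_UNIV)
  also have "{1..CARD('n)} - {1..m} = {m<..CARD('n)}"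
    by auto
  finally have eq: "- e ` {1..m} = e ` {m<..CARD('n)}" .
  have "(\<forall>i. i \<notin> e ` {1..m} \<longrightarrow> x $ i = 0) \<longleftrightarrow> (\<forall>k\<in>{m<..CARD('n)}. x $ e k = 0)" for x :: "real ^ 'n"
    using eq by (subst Compl_iff[symmetric], subst eq) blast
  then have "first_coords_subspace e m = {x. \<forall>i. i \<notin> e ` {1..m} \<longrightarrow> x $ i = 0}"
    by (simp add: first_coords_subspace_def)
  moreover have "card (e ` {1..m}) = m"
    using inj assms(2) by (subst card_image) (auto intro: inj_on_subset)
  ultimately show ?thesis
    using dim_substandard_cart[where 'a = real, of "e ` {1..m}"] by (simp only: dim_vec_eq)
qed

text \<open>Translating a point \<open>b\<close> of \<open>S\<close> to the origin turns affine
  dimension into linear dimension, and the translated points \<open>a - b\<close> are already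
  differences.\<close>

lemma aff_dim_le_dim_differences:
  fixes S :: "'a::euclidean_space set"
  shows "aff_dim S \<le> int (dim {a - b | a b. a \<in> S \<and> b \<in> S})"
proof (cases "S = {}")
  case False
  then obtain b where "b \<in> S" by blast
  then have "aff_dim S = int (dim ((\<lambda>a. a - b) ` S))"
    by (simp add: aff_dim_eq_dim_subtract hull_inc)
  also have "\<dots> \<le> int (dim {a - b | a b. a \<in> S \<and> b \<in> S})"
    using \<open>b \<in> S\<close> by (auto intro!: dim_subset)
  finally show ?thesis .
qed auto

lemma aff_dim_affine_bijection_image:
  assumes "affine_bijection A"
  shows "aff_dim (A ` S) = aff_dim S"
proof -
  obtain L b where L: "linear L" "\<And>x. A x = L x + b" and "inj A"
    using assms by (auto simp: affine_bijection_def bij_def)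
  then have "inj L"
    by (auto simp: inj_def)
  have "A ` S = (+) b ` L ` S"
    by (auto simp: L(2) image_image add.commute)
  then show ?thesis
    by (simp add: aff_dim_translation_eq aff_dim_injective_linear_image[OF L(1) \<open>inj L\<close>])
qed

text \<open>For finite nonempty \<open>S\<close> the supremum is a maximum, so a norm bound amounts
  to finitely many linear inequalities.\<close>

lemma laurent_norm_le_iff:
  assumes "finite S" and "S \<noteq> {}"
  shows "laurent_norm S \<phi> \<le> c \<longleftrightarrow> (\<forall>\<alpha>\<in>S. \<forall>\<beta>\<in>S. \<phi> \<bullet> (\<alpha> - \<beta>) \<le> c)"
  unfolding laurent_norm_def using assms
  by (subst cSUP_le_iff) auto

theorem theorem1p6:
  fixes f :: "'n::finite laurent_poly"
    and m :: nat
    and e :: "nat \<Rightarrow> 'n"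
    and A :: "real ^ 'n \<Rightarrow> real ^ 'n"
  assumes "f \<noteq> 0"
    and "aff_dim (newton_polyhedron f) = int m"
    and "essential_coordinates f m e A"
  shows "polytope (reduced_unit_ball f m e A)"
proof -
  define S where "S = A ` laurent_supp f"
  define W where "W = first_coords_subspace e m"
  define D where "D = {\<alpha> - \<beta> | \<alpha> \<beta>. \<alpha> \<in> S \<and> \<beta> \<in> S}"
  have num: "coord_numbering e" and bij: "affine_bijection A"
    and sub: "A ` newton_polyhedron f \<subseteq> W"
    using assms(3) by (auto simp: essential_coordinates_def W_def)
  have S: "finite S" "S \<noteq> {}"
    using assms(1) by (auto simp: S_def laurent_supp_def)
  \<comment> \<open>Swapping \<alpha> and \<beta> negates a difference.\<close>
  have D: "finite D" "\<And>d. d \<in> D \<Longrightarrow> - d \<in> D"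
    using finite_image_set2[of "\<lambda>x. x \<in> S" "\<lambda>x. x \<in> S" "(-)"] S(1)
    unfolding D_def by (auto, metis)
  have "subspace W"
    by (simp add: W_def subspace_first_coords_subspace)
  have "S \<subseteq> W"
    using sub hull_subset[of "laurent_supp f" convex] by (auto simp: S_def newton_polyhedron_def)
  then have "span D \<subseteq> W"
    using \<open>subspace W\<close> unfolding D_def by (intro span_minimal) (blast intro: subspace_diff)+
  \<comment> \<open>A dimension count gives \<open>span D = W\<close>: the exponents have affine
    dimension exactly \<open>m\<close>, so their differences span at least \<open>m\<close>
    dimensions inside the \<open>m\<close>-dimensional \<open>W\<close>. Hence no direction of
    \<open>W\<close> is left in which the ball could be unbounded.\<close>
  have "int m = aff_dim S"
    using assms(2) aff_dim_affine_bijection_image[OF bij]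
    by (simp add: S_def newton_polyhedron_def aff_dim_convex_hull)
  also have "\<dots> \<le> int (dim D)"
    unfolding D_def by (rule aff_dim_le_dim_differences)
  finally have "m \<le> dim (span D)"
    by simp
  moreover have "m \<le> CARD('n)"
    using assms(2) aff_dim_le_DIM[of "newton_polyhedron f"] by simp
  then have "dim W = m"
    unfolding W_def by (rule dim_first_coords_subspace[OF num])
  ultimately have "span D = W"
    using \<open>span D \<subseteq> W\<close> \<open>subspace W\<close> by (intro subspace_dim_equal) auto
  then have "reduced_unit_ball f m e A = {\<phi> \<in> span D. \<forall>d\<in>D. \<phi> \<bullet> d \<le> 1}"
    unfolding reduced_unit_ball_def S_def[symmetric] W_def[symmetric] laurent_norm_le_iff[OF S]
    by (auto simp: D_def)
  then show ?thesis
    using polytope_dual_of_span[OF D] by simp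
qed

end
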